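(* Let $(E,\mathcal{F},\tau)$ be a real locally convex space, $\psi:E\to\mathbb{R}$ a seminorm, $K\subseteq E$ a nontrivial, pointed cone with normlike-base $B_K$, and $A\subseteq E$ a $\tau$-closed, nontrivial cone with normlike-base $B_A$ (both with respect to $\psi$). Define $S_{-K}:=\mathrm{conv}(-B_K)$ and $S_{\partial A}^0:=\mathrm{conv}((B_A\cap\mathrm{bd}_\tau\,A)\cup\{0\})$. Consider the two assertions: $1^\circ$ $(\mathrm{cl}_\tau\,S_{\partial A}^0)\cap(\mathrm{cl}_\tau\,S_{-K})=\emptyset$. $2^\circ$ There exists $(x^*,\alpha)\in K_\tau^{a\#}\cap(E^*\times\mathbb{P})$ such that $$x^*(a)+\alpha\psi(a)\ \geq\ 0\ \geq\ x^*(k)+\alpha\psi(k)\quad\text{for all } a\in\mathrm{bd}_\tau\,A\text{ and }k\in -K,$$ $$x^*(a)+\alpha\psi(a)\ >\ 0\ >\ x^*(k)+\alpha\psi(k)\quad\text{for all } a\in(\mathrm{bd}_\tau\,A)\setminus\{0\}\text{ and }k\in -K\setminus\{0\}.$$ If one of the sets $\mathrm{cl}_\tau\,S_{-K}$ and $\mathrm{cl}_\tau\,S_{\partial A}^0$ is $\tau$-compact, then $1^\circ\Longrightarrow 2^\circ$. If either (a) $B_K$ is $\tau$-compact, or (b) $\mathrm{cl}_\tau\,S_{-K}$ is $\tau$-compact, $\psi$ is $\tau$-continuous (e.g., $\psi\in\mathcal{F}$), and $K$ is $\tau$-closed and convex, then $2^\circ\Longrightarrow 1^\circ$.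
   Context: $(E,\mathcal{F},\tau)$ denotes a real locally convex space $E\neq\{0\}$ whose topology $\tau$ is generated by a family $\mathcal{F}$ of seminorms (not assumed Hausdorff). $E'$ is the algebraic dual and $E^*=(E,\tau)^*$ the topological dual; $\mathbb{R}_+=[0,\infty)$, $\mathbb{P}=(0,\infty)$. A set $K\subseteq E$ is a cone if $0\in K=\mathbb{R}_+\cdot K$ (not necessarily convex); it is nontrivial if $\{0\}\neq K\neq E$, pointed if $K\cap(-K)=\{0\}$. A seminorm is a sublinear symmetric function $\psi:E\to\mathbb{R}$ (not assumed $\tau$-continuous unless stated). A nontrivial cone $K$ has a normlike-base (w.r.t. $\psi$) if $\psi(x)>0$ for all $x\in K\setminus\{0\}$; the normlike-base is then $B_K:=\{x\in K\mid \psi(x)=1\}$. All normlike-bases are taken with respect to the same fixed seminorm $\psi$. $\mathrm{cl}_\tau$ is $\tau$-closure, $\mathrm{bd}_\tau$ the $\tau$-boundary, $\mathrm{conv}$ the convex hull; $\tau$-compact means every $\tau$-open cover has a finite subcover. $-K\setminus\{0\}$ means $(-K)\setminus\{0\}$. $K^\#:=\{y'\in E'\mid \forall k\in K\setminus\{0\}:\ y'(k)>0\}$, $K^{a\#}:=\{(x',\alpha)\in K^\#\times\mathbb{R}_+\mid \forall y\in K\setminus\{0\}:\ x'(y)-\alpha\psi(y)>0\}$, and $K_\tau^{a\#}:=K^{a\#}\cap(E^*\times\mathbb{R})$. *)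

theory Defs
  imports "HOL-Analysis.Analysis"
begin

text \<open>
  The vector space \<open>E\<close> is the universe of a type of class \<open>real_vector\<close>.  Its topology
  is a value of type \<open>'a topology\<close>, because it need not be Hausdorff (so no metric or norm
  type class fits) and because it is determined by a family of seminorms.
\<close>

definition sublinear :: "('a::real_vector \<Rightarrow> real) \<Rightarrow> bool" where
  "sublinear p \<longleftrightarrow>
     (\<forall>x y. p (x + y) \<le> p x + p y) \<and> (\<forall>t x. 0 \<le> t \<longrightarrow> p (t *\<^sub>R x) = t * p x)"

definition seminorm :: "('a::real_vector \<Rightarrow> real) \<Rightarrow> bool" where
  "seminorm p \<longleftrightarrow> sublinear p \<and> (\<forall>x. p (- x) = p x)"

text \<open>
  A set is open iff around each of its points it contains a finite intersection of open
  seminorm balls of a common radius; the empty intersection is the whole space.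
\<close>

definition seminorm_topology :: "('a::real_vector \<Rightarrow> real) set \<Rightarrow> 'a topology" where
  "seminorm_topology F = topology (\<lambda>U. \<forall>x\<in>U. \<exists>G e. finite G \<and> G \<subseteq> F \<and> 0 < e \<and>
     {y. \<forall>p\<in>G. p (y - x) < e} \<subseteq> U)"

lemma istopology_seminorm:
  "istopology (\<lambda>U::'a::real_vector set. \<forall>x\<in>U. \<exists>G e. finite G \<and> G \<subseteq> F \<and> 0 < (e::real) \<and>
     {y. \<forall>p\<in>G. p (y - x) < e} \<subseteq> U)"
proof -
  define nbhd where "nbhd \<equiv> \<lambda>x (U::'a set). \<exists>G e. finite G \<and> G \<subseteq> F \<and> 0 < (e::real) \<and>
     {y. \<forall>p\<in>G. p (y - x) < e} \<subseteq> U"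
  have inter: "nbhd x (S \<inter> T)" if "nbhd x S" and "nbhd x T" for x S T
  proof -
    obtain G d where G: "finite G" "G \<subseteq> F" "0 < (d::real)" "{y. \<forall>p\<in>G. p (y - x) < d} \<subseteq> S"
      using \<open>nbhd x S\<close> unfolding nbhd_def by (elim exE conjE)
    obtain H e where H: "finite H" "H \<subseteq> F" "0 < (e::real)" "{y. \<forall>p\<in>H. p (y - x) < e} \<subseteq> T"
      using \<open>nbhd x T\<close> unfolding nbhd_def by (elim exE conjE)
    have "{y. \<forall>p\<in>G \<union> H. p (y - x) < min d e} \<subseteq> S \<inter> T"
      using G(4) H(4) by auto
    then show ?thesis
      unfolding nbhd_def using G(1-3) H(1-3)
      by (intro exI[of _ "G \<union> H"] exI[of _ "min d e"] conjI) simp_all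
  qed
  have mono: "nbhd x T" if "nbhd x S" and "S \<subseteq> T" for x S T
  proof -
    obtain G d where G: "finite G" "G \<subseteq> F" "0 < (d::real)" "{y. \<forall>p\<in>G. p (y - x) < d} \<subseteq> S"
      using \<open>nbhd x S\<close> unfolding nbhd_def by (elim exE conjE)
    have "{y. \<forall>p\<in>G. p (y - x) < d} \<subseteq> T"
      using G(4) \<open>S \<subseteq> T\<close> by (rule subset_trans)
    then show ?thesis
      unfolding nbhd_def using G(1-3) by (intro exI[of _ G] exI[of _ d] conjI)
  qed
  have "istopology (\<lambda>U. \<forall>x\<in>U. nbhd x U)"
    unfolding istopology_def by (meson Int_iff UnionE Union_upper inter mono)
  then show ?thesis
    unfolding nbhd_def .
qed

lemma openin_seminorm_topology:
  "openin (seminorm_topology F) U \<longleftrightarrow> (\<forall>x\<in>U. \<exists>G e. finite G \<and> G \<subseteq> F \<and> 0 < e \<and>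
     {y. \<forall>p\<in>G. p (y - x) < e} \<subseteq> U)"
  unfolding seminorm_topology_def by (simp only: topology_inverse'[OF istopology_seminorm])

lemma topspace_seminorm_topology [simp]: "topspace (seminorm_topology F) = UNIV"
proof -
  have "openin (seminorm_topology F) UNIV"
    unfolding openin_seminorm_topology
    by (intro ballI exI[of _ "{}"] exI[of _ "1::real"]) simp
  then show ?thesis
    by (metis openin_subset top.extremum_uniqueI)
qed

definition locally_convex_space :: "('a::real_vector \<Rightarrow> real) set \<Rightarrow> 'a topology \<Rightarrow> bool" where
  "locally_convex_space F \<tau> \<longleftrightarrow>
     (UNIV :: 'a set) \<noteq> {0} \<and> (\<forall>p\<in>F. seminorm p) \<and> \<tau> = seminorm_topology F"

definition algebraic_dual :: "('a::real_vector \<Rightarrow> real) set" where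
  "algebraic_dual = {x'. linear x'}"

definition topological_dual :: "'a::real_vector topology \<Rightarrow> ('a \<Rightarrow> real) set" where
  "topological_dual \<tau> = {x' \<in> algebraic_dual. continuous_map \<tau> euclideanreal x'}"

definition is_cone :: "'a::real_vector set \<Rightarrow> bool" where
  "is_cone K \<longleftrightarrow> 0 \<in> K \<and> K = {t *\<^sub>R x | t x. 0 \<le> t \<and> x \<in> K}"

text \<open>The library predicate \<^const>\<open>cone\<close> also holds of the empty set.\<close>

lemma is_cone_iff_cone: "is_cone K \<longleftrightarrow> 0 \<in> K \<and> cone K"
proof -
  define RK where "RK = {t *\<^sub>R x | t x. 0 \<le> t \<and> x \<in> K}"
  have "K \<subseteq> RK"
  proof
    fix x assume "x \<in> K"
    then have "x = 1 *\<^sub>R x \<and> 0 \<le> (1::real) \<and> x \<in> K" by simp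
    then show "x \<in> RK"
      unfolding RK_def by (intro CollectI exI)
  qed
  moreover have "RK \<subseteq> K \<longleftrightarrow> cone K"
    unfolding RK_def cone_def by (auto simp: subset_iff)
  ultimately have "K = RK \<longleftrightarrow> cone K"
    by (metis order_refl subset_antisym)
  then show ?thesis
    unfolding is_cone_def RK_def by (rule conj_cong[OF refl])
qed

definition nontrivial_cone :: "'a::real_vector set \<Rightarrow> bool" where
  "nontrivial_cone K \<longleftrightarrow> is_cone K \<and> {0} \<noteq> K \<and> K \<noteq> UNIV"

definition pointed :: "'a::real_vector set \<Rightarrow> bool" where
  "pointed K \<longleftrightarrow> K \<inter> uminus ` K = {0}"

definition has_normlike_base :: "('a::real_vector \<Rightarrow> real) \<Rightarrow> 'a set \<Rightarrow> bool" where
  "has_normlike_base \<psi> K \<longleftrightarrow> (\<forall>x \<in> K - {0}. 0 < \<psi> x)"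

definition normlike_base :: "('a::real_vector \<Rightarrow> real) \<Rightarrow> 'a set \<Rightarrow> 'a set" where
  "normlike_base \<psi> K = {x \<in> K. \<psi> x = 1}"

definition dual_sharp :: "'a::real_vector set \<Rightarrow> ('a \<Rightarrow> real) set" where
  "dual_sharp K = {y' \<in> algebraic_dual. \<forall>k \<in> K - {0}. 0 < y' k}"

definition aug_dual_sharp ::
    "('a::real_vector \<Rightarrow> real) \<Rightarrow> 'a set \<Rightarrow> (('a \<Rightarrow> real) \<times> real) set" where
  "aug_dual_sharp \<psi> K =
     {(x', \<alpha>) \<in> dual_sharp K \<times> {0..}. \<forall>y \<in> K - {0}. 0 < x' y - \<alpha> * \<psi> y}"

definition top_aug_dual_sharp ::
    "'a::real_vector topology \<Rightarrow> ('a \<Rightarrow> real) \<Rightarrow> 'a set \<Rightarrow> (('a \<Rightarrow> real) \<times> real) set" where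
  "top_aug_dual_sharp \<tau> \<psi> K = aug_dual_sharp \<psi> K \<inter> (topological_dual \<tau> \<times> UNIV)"

end

theory Submission
  imports Defs
begin

text \<open>
  For the first implication a strict separation of the two disjoint closed convex sets yields a
  functional whose values on \<open>S\<^sub>-\<^sub>K\<close> and on \<open>S\<^sup>0\<close> are separated by a
  number \<open>- \<alpha>\<close>; it is negative because \<open>0 \<in> S\<^sup>0\<close>.  As \<open>\<psi> = 1\<close> on the bases, the
  claimed inequalities hold there and extend to the cones by homogeneity.  The separation
  comes from the Mazur--Orlicz theorem applied to a finite sum of seminorms that is bounded
  away from zero on the difference of the two sets.

  Conversely, compactness of \<open>B\<^sub>K\<close> makes the supremum of \<open>x'\<close> over \<open>- B\<^sub>K\<close> a
  maximum, so it lies strictly below \<open>- \<alpha>\<close>, and this bound passes to closed convex hulls.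
  Under (b), \<open>B\<^sub>K\<close> is a closed subset of a compact set, which reduces (b) to (a).
\<close>

section \<open>Sublinear functionals and the Mazur--Orlicz theorem\<close>

lemma sublinear_add: "sublinear p \<Longrightarrow> p (x + y) \<le> p x + p y"
  by (simp add: sublinear_def)

lemma sublinear_scaleR: "sublinear p \<Longrightarrow> 0 \<le> t \<Longrightarrow> p (t *\<^sub>R x) = t * p x"
  by (simp add: sublinear_def)

lemma sublinear_zero: "sublinear p \<Longrightarrow> p 0 = 0"
  using sublinear_scaleR[of p 0 0] by simp

lemma sublinear_neg_le: "sublinear p \<Longrightarrow> - p (- x) \<le> p x"
  using sublinear_add[of p x "- x"] by (simp add: sublinear_zero)

text \<open>Oddness turns subadditivity at \<open>- x\<close> and \<open>- y\<close> into
  superadditivity at \<open>x\<close> and \<open>y\<close>, and carries positive homogeneity over to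
  negative scalars.\<close>

lemma sublinear_odd_imp_linear:
  assumes "sublinear p" and odd: "\<And>x. p (- x) = - p x"
  shows "linear p"
proof (rule linearI)
  fix x y
  have "- p x - p y \<ge> - p (x + y)"
    using sublinear_add[OF \<open>sublinear p\<close>, of "- x" "- y"] odd[of "x + y"] odd by simp
  then show "p (x + y) = p x + p y"
    using sublinear_add[OF \<open>sublinear p\<close>, of x y] by linarith
next
  fix t :: real and x
  show "p (t *\<^sub>R x) = t *\<^sub>R p x"
  proof (cases "0 \<le> t")
    case True
    then show ?thesis
      using sublinear_scaleR[OF \<open>sublinear p\<close>] by simp
  next
    case False
    then have "p ((- t) *\<^sub>R x) = (- t) * p x"
      using sublinear_scaleR[OF \<open>sublinear p\<close>, of "- t" x] by simp
    then show ?thesis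
      using odd[of "t *\<^sub>R x"] by simp
  qed
qed

text \<open>A common tool for the minorant construction and for lower bounds of chains. The
  condition \<open>add\<close> is a directedness condition: two members evaluated at different
  points are beaten by a single member at the sum. In \<open>scale\<close> one inequality suffices,
  because the other follows by using the inverse factor.\<close>

lemma sublinear_cINF:
  fixes h :: "'i \<Rightarrow> 'a::real_vector \<Rightarrow> real"
  assumes "I \<noteq> {}"
    and bdd: "\<And>x. bdd_below ((\<lambda>i. h i x) ` I)"
    and add: "\<And>i j x y. i \<in> I \<Longrightarrow> j \<in> I \<Longrightarrow> \<exists>k\<in>I. h k (x + y) \<le> h i x + h j y"
    and scale: "\<And>i t x. i \<in> I \<Longrightarrow> 0 < t \<Longrightarrow> \<exists>k\<in>I. h k (t *\<^sub>R x) \<le> t * h i x"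
    and zero: "(INF i\<in>I. h i 0) = 0"
  shows "sublinear (\<lambda>x. INF i\<in>I. h i x)"
proof -
  have scale_le: "(INF i\<in>I. h i (t *\<^sub>R x)) \<le> t * (INF i\<in>I. h i x)" if "0 < t" for t x
  proof -
    have "(INF i\<in>I. h i (t *\<^sub>R x)) / t \<le> (INF i\<in>I. h i x)"
    proof (rule cINF_greatest[OF \<open>I \<noteq> {}\<close>])
      fix i assume "i \<in> I"
      then obtain k where k: "k \<in> I" "h k (t *\<^sub>R x) \<le> t * h i x"
        using scale \<open>0 < t\<close> by blast
      have "(INF i\<in>I. h i (t *\<^sub>R x)) \<le> t * h i x"
        using cINF_lower2[OF bdd k] .
      then show "(INF i\<in>I. h i (t *\<^sub>R x)) / t \<le> h i x"
        using \<open>0 < t\<close> by (simp add: divide_le_eq mult.commute)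
    qed
    then show ?thesis
      using \<open>0 < t\<close> by (simp add: divide_le_eq mult.commute)
  qed
  show ?thesis
    unfolding sublinear_def
  proof (intro conjI allI impI)
    fix x y
    have "(INF i\<in>I. h i (x + y)) - (INF j\<in>I. h j y) \<le> (INF i\<in>I. h i x)"
    proof (rule cINF_greatest[OF \<open>I \<noteq> {}\<close>])
      fix i assume "i \<in> I"
      have "(INF i\<in>I. h i (x + y)) - h i x \<le> (INF j\<in>I. h j y)"
      proof (rule cINF_greatest[OF \<open>I \<noteq> {}\<close>])
        fix j assume "j \<in> I"
        then obtain k where k: "k \<in> I" "h k (x + y) \<le> h i x + h j y"
          using add \<open>i \<in> I\<close> by blast
        show "(INF i\<in>I. h i (x + y)) - h i x \<le> h j y"
          using cINF_lower2[OF bdd k] by simp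
      qed
      then show "(INF i\<in>I. h i (x + y)) - (INF j\<in>I. h j y) \<le> h i x"
        by linarith
    qed
    then show "(INF i\<in>I. h i (x + y)) \<le> (INF i\<in>I. h i x) + (INF i\<in>I. h i y)"
      by linarith
  next
    fix t :: real and x
    assume "0 \<le> t"
    show "(INF i\<in>I. h i (t *\<^sub>R x)) = t * (INF i\<in>I. h i x)"
    proof (cases "t = 0")
      case True
      then show ?thesis
        using zero by simp
    next
      case False
      then have "0 < t"
        using \<open>0 \<le> t\<close> by simp
      \<comment> \<open>The reverse inequality is \<open>scale_le\<close> for the factor
        \<open>inverse t\<close> at the point \<open>t *\<^sub>R x\<close>.\<close>
      have "(INF i\<in>I. h i (inverse t *\<^sub>R t *\<^sub>R x)) \<le> inverse t * (INF i\<in>I. h i (t *\<^sub>R x))"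
        using scale_le \<open>0 < t\<close> by (meson positive_imp_inverse_positive)
      then have "t * (INF i\<in>I. h i x) \<le> (INF i\<in>I. h i (t *\<^sub>R x))"
        using \<open>0 < t\<close> by (simp add: field_simps)
      then show ?thesis
        using scale_le[OF \<open>0 < t\<close>, of x] by linarith
    qed
  qed
qed

text \<open>
  The witness is the infimum of \<open>p (x + t *\<^sub>R m) - t * c\<close> over \<open>t \<ge> 0\<close> and \<open>m \<in> M\<close>.
\<close>

lemma sublinear_minorant:
  fixes p :: "'a::real_vector \<Rightarrow> real"
  assumes p: "sublinear p" and M: "convex M" "M \<noteq> {}" and c: "\<And>m. m \<in> M \<Longrightarrow> c \<le> p m"
  obtains g where "sublinear g" and "\<And>x. g x \<le> p x" and "\<And>m. m \<in> M \<Longrightarrow> g (- m) \<le> - c"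
proof -
  define I where "I = {0::real..} \<times> M"
  define h where "h = (\<lambda>i x. p (x + fst i *\<^sub>R snd i) - fst i * c)"
  define g where "g = (\<lambda>x. INF i\<in>I. h i x)"
  obtain m0 where m0: "m0 \<in> M"
    using M(2) by blast
  have I_ne: "I \<noteq> {}"
    using m0 by (auto simp: I_def)
  \<comment> \<open>This bound, independent of \<open>i\<close>, keeps the infimum finite; it is
    where the hypothesis that \<open>p\<close> is at least \<open>c\<close> on \<open>M\<close>
    enters.\<close>
  have lower: "- p (- x) \<le> h i x" if "i \<in> I" for i x
  proof -
    have i: "0 \<le> fst i" "snd i \<in> M"
      using that by (auto simp: I_def)
    have "fst i * c \<le> p (fst i *\<^sub>R snd i)"
      using i c by (simp add: sublinear_scaleR[OF p] mult_left_mono)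
    also have "\<dots> \<le> p (x + fst i *\<^sub>R snd i) + p (- x)"
      using sublinear_add[OF p, of "x + fst i *\<^sub>R snd i" "- x"] by simp
    finally show ?thesis
      by (simp add: h_def)
  qed
  have bdd: "bdd_below ((\<lambda>i. h i x) ` I)" for x
    by (rule bdd_belowI2[of _ "- p (- x)"]) (rule lower)
  have g_le: "g x \<le> h i x" if "i \<in> I" for i x
    unfolding g_def using bdd that by (rule cINF_lower)
  have g_le_p: "g x \<le> p x" for x
    using g_le[of "(0, m0)" x] m0 by (simp add: I_def h_def)
  have "sublinear g"
    unfolding g_def
  proof (rule sublinear_cINF[OF I_ne bdd])
    fix i j x y
    assume "i \<in> I" "j \<in> I"
    then obtain s m t n where ij: "i = (s, m)" "j = (t, n)" "0 \<le> s" "0 \<le> t" "m \<in> M" "n \<in> M"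
      by (auto simp: I_def)
    \<comment> \<open>Convexity merges two indices into one: \<open>k\<close> is the mean of
      \<open>m\<close> and \<open>n\<close> with weights proportional to \<open>s\<close> and
      \<open>t\<close>. If both weights vanish, any point of \<open>M\<close> serves.\<close>
    obtain k where k: "k \<in> M" "(s + t) *\<^sub>R k = s *\<^sub>R m + t *\<^sub>R n"
    proof (cases "s + t = 0")
      case True
      then show ?thesis
        using that[of m] ij by (simp add: add_nonneg_eq_0_iff)
    next
      case False
      then have "(s / (s + t)) *\<^sub>R m + (t / (s + t)) *\<^sub>R n \<in> M"
        using ij by (intro convexD[OF M(1)]) (auto simp: add_divide_distrib[symmetric])
      then show ?thesis
        using that False by (simp add: scaleR_add_right)
    qed
    have "p (x + y + (s + t) *\<^sub>R k) \<le> p (x + s *\<^sub>R m) + p (y + t *\<^sub>R n)"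
      using sublinear_add[OF p, of "x + s *\<^sub>R m" "y + t *\<^sub>R n"]
      unfolding k(2) by (simp add: algebra_simps)
    then have "h (s + t, k) (x + y) \<le> h i x + h j y"
      by (simp add: h_def ij algebra_simps)
    moreover have "(s + t, k) \<in> I"
      using k(1) ij by (simp add: I_def)
    ultimately show "\<exists>k\<in>I. h k (x + y) \<le> h i x + h j y" ..
  next
    fix i and t :: real and x
    assume "i \<in> I" "0 < t"
    then have "(t * fst i, snd i) \<in> I"
      by (auto simp: I_def)
    moreover have "h (t * fst i, snd i) (t *\<^sub>R x) = t * h i x"
      using sublinear_scaleR[OF p, of t "x + fst i *\<^sub>R snd i"] \<open>0 < t\<close>
      by (simp add: h_def algebra_simps)
    ultimately show "\<exists>k\<in>I. h k (t *\<^sub>R x) \<le> t * h i x"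
      by (metis order_refl)
  next
    have "0 \<le> g 0"
      unfolding g_def using lower[of _ 0] sublinear_zero[OF p]
      by (intro cINF_greatest[OF I_ne]) simp
    then show "(INF i\<in>I. h i 0) = 0"
      using g_le_p[of 0] sublinear_zero[OF p] by (simp add: g_def)
  qed
  moreover have "g (- m) \<le> - c" if "m \<in> M" for m
    \<comment> \<open>At the index \<open>(1, m)\<close> and the point \<open>- m\<close> the
      argument of \<open>p\<close> cancels to zero, which leaves \<open>- c\<close>.\<close>
    using g_le[of "(1, m)" "- m"] that sublinear_zero[OF p] by (simp add: I_def h_def)
  ultimately show ?thesis
    using that g_le_p by blast
qed

text \<open>A form of Hahn--Banach. Zorn's lemma gives a minimal sublinear \<open>f\<close> below
  \<open>p\<close>. For any \<open>y\<close>, the minorant for the set \<open>{y}\<close> and the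
  constant \<open>f y\<close> must equal \<open>f\<close> by minimality, and its value at
  \<open>- y\<close> forces \<open>f\<close> to be odd, hence linear.\<close>

lemma sublinear_dominates_linear:
  fixes p :: "'a::real_vector \<Rightarrow> real"
  assumes p: "sublinear p"
  obtains f where "linear f" and "\<And>x. f x \<le> p x"
proof -
  define S where "S = {g. sublinear g \<and> g \<le> p}"
  \<comment> \<open>The order is reversed, so a maximal element in the sense of Zorn is a minimal
    functional.\<close>
  have "\<exists>f\<in>S. \<forall>g\<in>S. f \<ge> g \<longrightarrow> g = f"
  proof (rule predicate_Zorn)
    show "partial_order_on S (relation_of (\<ge>) S)"
      by (rule partial_order_on_relation_ofI) auto
  next
    fix C
    assume "C \<in> Chains (relation_of (\<ge>) S)"
    then have CS: "C \<subseteq> S" and chain: "\<And>g h. g \<in> C \<Longrightarrow> h \<in> C \<Longrightarrow> g \<le> h \<or> h \<le> g"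
      by (auto simp: Chains_def relation_of_def)
    show "\<exists>u\<in>S. \<forall>a\<in>C. a \<ge> u"
    proof (cases "C = {}")
      case True
      then show ?thesis
        using p by (auto simp: S_def)
    next
      case False
      define u where "u = (\<lambda>x. INF g\<in>C. g x)"
      have sub: "sublinear g" and le: "g x \<le> p x" if "g \<in> C" for g x
        using CS that by (auto simp: S_def le_fun_def)
      have bdd: "bdd_below ((\<lambda>g. g x) ` C)" for x
      proof (rule bdd_belowI2)
        fix g assume "g \<in> C"
        show "- p (- x) \<le> g x"
          using sublinear_neg_le[OF sub[OF \<open>g \<in> C\<close>], of x] le[OF \<open>g \<in> C\<close>, of "- x"] by linarith
      qed
      have u_le: "u \<le> g" if "g \<in> C" for g
        unfolding u_def le_fun_def using bdd that by (auto intro: cINF_lower)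
      have "sublinear u"
        unfolding u_def
      proof (rule sublinear_cINF[OF False bdd])
        fix g h x y
        assume "g \<in> C" "h \<in> C"
        \<comment> \<open>The smaller of two comparable members bounds the values at both points, so
          it can be used at the sum.\<close>
        then consider "g \<le> h" | "h \<le> g"
          using chain by blast
        then show "\<exists>k\<in>C. k (x + y) \<le> g x + h y"
        proof cases
          case 1
          then have "g (x + y) \<le> g x + h y"
            using sublinear_add[OF sub[OF \<open>g \<in> C\<close>], of x y] le_funD[OF 1, of y] by linarith
          then show ?thesis
            using \<open>g \<in> C\<close> by blast
        next
          case 2
          then have "h (x + y) \<le> g x + h y"
            using sublinear_add[OF sub[OF \<open>h \<in> C\<close>], of x y] le_funD[OF 2, of x] by linarith
          then show ?thesis
            using \<open>h \<in> C\<close> by blast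
        qed
      next
        fix g and t :: real and x
        assume "g \<in> C" "0 < t"
        then show "\<exists>k\<in>C. k (t *\<^sub>R x) \<le> t * g x"
          using sublinear_scaleR[OF sub] by (metis less_imp_le order_refl)
      next
        show "(INF g\<in>C. g 0) = 0"
          using False by (simp add: sublinear_zero[OF sub] cong: INF_cong)
      qed
      moreover have "u \<le> p"
        using False u_le CS by (force simp: S_def intro: order_trans)
      ultimately show ?thesis
        using u_le by (auto simp: S_def)
    qed
  qed
  then obtain f where f: "sublinear f" "f \<le> p"
    and minimal: "\<And>g. sublinear g \<Longrightarrow> g \<le> f \<Longrightarrow> g = f"
    by (auto simp: S_def intro: order_trans)
  have "f (- y) = - f y" for y
  proof -
    obtain g where g: "sublinear g" "\<And>x. g x \<le> f x" "g (- y) \<le> - f y"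
      using sublinear_minorant[OF f(1), of "{y}" "f y"] by auto
    have "g = f"
      using g by (intro minimal) (simp_all add: le_fun_def)
    then show ?thesis
      using g(3) sublinear_neg_le[OF f(1), of y] by simp
  qed
  then have "linear f"
    using f(1) by (intro sublinear_odd_imp_linear)
  then show ?thesis
    using that f(2) by (simp add: le_fun_def)
qed

text \<open>A linear \<open>f\<close> below the minorant \<open>g\<close> satisfies
  \<open>f (- m) \<le> - c\<close> on \<open>M\<close>, and linearity turns this upper bound into
  the desired lower bound.\<close>

theorem Mazur_Orlicz:
  fixes p :: "'a::real_vector \<Rightarrow> real"
  assumes "sublinear p" and "convex M" and "M \<noteq> {}" and "\<And>m. m \<in> M \<Longrightarrow> c \<le> p m"
  obtains f where "linear f" and "\<And>x. f x \<le> p x" and "\<And>m. m \<in> M \<Longrightarrow> c \<le> f m"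
proof -
  obtain g where g: "sublinear g" "\<And>x. g x \<le> p x" "\<And>m. m \<in> M \<Longrightarrow> g (- m) \<le> - c"
    using sublinear_minorant[OF assms] by blast
  obtain f where f: "linear f" "\<And>x. f x \<le> g x"
    using sublinear_dominates_linear[OF g(1)] by blast
  have "c \<le> f m" if "m \<in> M" for m
    using g(3)[OF that] f(2)[of "- m"] linear_neg[OF f(1), of m] by linarith
  then show ?thesis
    using that f g(2) by (meson order_trans)
qed

section \<open>Seminorm topologies and strict separation\<close>

lemma seminorm_zero: "seminorm p \<Longrightarrow> p 0 = 0"
  by (simp add: seminorm_def sublinear_zero)

lemma seminorm_minus: "seminorm p \<Longrightarrow> p (- x) = p x"
  by (simp add: seminorm_def)

lemma seminorm_minus_commute: "seminorm p \<Longrightarrow> p (x - y) = p (y - x)"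
  using seminorm_minus[of p "x - y"] by simp

lemma seminorm_nonneg: "seminorm p \<Longrightarrow> 0 \<le> p x"
  using sublinear_neg_le[of p x] by (simp add: seminorm_def)

lemma seminorm_scaleR:
  assumes "seminorm p"
  shows "p (t *\<^sub>R x) = \<bar>t\<bar> * p x"
proof -
  have "p (\<bar>t\<bar> *\<^sub>R x) = p (t *\<^sub>R x)"
    using seminorm_minus[OF assms, of "t *\<^sub>R x"] by (simp add: abs_if)
  then show ?thesis
    using assms sublinear_scaleR[of p "\<bar>t\<bar>" x] by (simp add: seminorm_def)
qed

lemma seminorm_triangle: "seminorm p \<Longrightarrow> p (x - z) \<le> p (x - y) + p (y - z)"
  using sublinear_add[of p "x - y" "y - z"] by (simp add: seminorm_def)

lemma seminorm_sum:
  "(\<And>p. p \<in> G \<Longrightarrow> seminorm p) \<Longrightarrow> seminorm (\<lambda>x. \<Sum>p\<in>G. p x)"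
  unfolding seminorm_def sublinear_def sum.distrib[symmetric] sum_distrib_left
  by (intro conjI allI impI sum_mono sum.cong refl) simp_all

text \<open>Replaces a finite intersection of balls by the ball of one seminorm, the sum over
  \<open>G\<close>. Each summand is at most the sum by nonnegativity, so the new ball is the smaller
  one.\<close>

lemma openin_seminorm_topology_imp_ball:
  assumes F: "\<And>p. p \<in> F \<Longrightarrow> seminorm p"
    and "openin (seminorm_topology F) U" and "x \<in> U"
  obtains G e where "finite G" "G \<subseteq> F" "0 < e" "{y. (\<Sum>p\<in>G. p (y - x)) < e} \<subseteq> U"
proof -
  obtain G e where G: "finite G" "G \<subseteq> F" "0 < e" "{y. \<forall>p\<in>G. p (y - x) < e} \<subseteq> U"
    using assms(2,3) unfolding openin_seminorm_topology by meson
  have "p (y - x) \<le> (\<Sum>p\<in>G. p (y - x))" if "p \<in> G" for p y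
    using G that F by (intro member_le_sum) (auto intro: seminorm_nonneg)
  then have "{y. (\<Sum>p\<in>G. p (y - x)) < e} \<subseteq> {y. \<forall>p\<in>G. p (y - x) < e}"
    by (auto intro: le_less_trans)
  then show ?thesis
    using that[OF G(1-3)] G(4) by blast
qed

lemma openin_seminorm_topologyI:
  assumes F: "\<And>p. p \<in> F \<Longrightarrow> seminorm p"
    and U: "\<And>x. x \<in> U \<Longrightarrow>
      \<exists>G e. finite G \<and> G \<subseteq> F \<and> 0 < e \<and> {y. (\<Sum>p\<in>G. p (y - x)) < e} \<subseteq> U"
  shows "openin (seminorm_topology F) U"
  unfolding openin_seminorm_topology
proof
  fix x assume "x \<in> U"
  then obtain G e where G: "finite G" "G \<subseteq> F" "0 < e" "{y. (\<Sum>p\<in>G. p (y - x)) < e} \<subseteq> U"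
    using U[OF \<open>x \<in> U\<close>] by (elim exE conjE)
  \<comment> \<open>The extra 1 makes the final estimate strict and covers the case of empty
    \<open>G\<close>.\<close>
  define d where "d = e / (real (card G) + 1)"
  have "0 < d"
    using G(3) by (simp add: d_def)
  have "(\<Sum>p\<in>G. p (y - x)) < e" if "\<forall>p\<in>G. p (y - x) < d" for y
  proof -
    have "(\<Sum>p\<in>G. p (y - x)) \<le> real (card G) * d"
      using that by (intro sum_bounded_above) (auto intro: less_imp_le)
    also have "\<dots> < (real (card G) + 1) * d"
      using \<open>0 < d\<close> by simp
    also have "\<dots> = e"
      by (simp add: d_def)
    finally show ?thesis .
  qed
  then have "{y. \<forall>p\<in>G. p (y - x) < d} \<subseteq> U"
    using G(4) by blast
  then show "\<exists>G e. finite G \<and> G \<subseteq> F \<and> 0 < e \<and> {y. \<forall>p\<in>G. p (y - x) < e} \<subseteq> U"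
    using G(1,2) \<open>0 < d\<close> by blast
qed

lemma openin_seminorm_ball:
  assumes F: "\<And>p. p \<in> F \<Longrightarrow> seminorm p" and G: "finite G" "G \<subseteq> F"
  shows "openin (seminorm_topology F) {y. (\<Sum>p\<in>G. p (y - x)) < e}"
proof (rule openin_seminorm_topologyI[OF F])
  have q: "seminorm (\<lambda>x. \<Sum>p\<in>G. p x)"
    using F G(2) by (intro seminorm_sum) blast
  fix y assume y: "y \<in> {y. (\<Sum>p\<in>G. p (y - x)) < e}"
  have "{z. (\<Sum>p\<in>G. p (z - y)) < e - (\<Sum>p\<in>G. p (y - x))} \<subseteq> {z. (\<Sum>p\<in>G. p (z - x)) < e}"
    by (auto intro: le_less_trans[OF seminorm_triangle[OF q, of _ x y]])
  then show "\<exists>H d. finite H \<and> H \<subseteq> F \<and> 0 < d \<and>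
      {z. (\<Sum>p\<in>H. p (z - y)) < d} \<subseteq> {z. (\<Sum>p\<in>G. p (z - x)) < e}"
    using y G by (intro exI[of _ G] exI[of _ "e - (\<Sum>p\<in>G. p (y - x))"]) auto
qed auto

lemma continuous_map_scaleR_seminorm_topology:
  assumes F: "\<And>p. p \<in> F \<Longrightarrow> seminorm p"
  shows "continuous_map (seminorm_topology F) (seminorm_topology F) (\<lambda>x. t *\<^sub>R x)"
  unfolding continuous_map
proof (intro conjI allI impI)
  fix U
  assume U: "openin (seminorm_topology F) U"
  let ?V = "{x \<in> topspace (seminorm_topology F). t *\<^sub>R x \<in> U}"
  show "openin (seminorm_topology F) ?V"
  proof (rule openin_seminorm_topologyI[OF F])
    fix x assume "x \<in> ?V"
    then obtain G e where G: "finite G" "G \<subseteq> F" "0 < e" "{y. (\<Sum>p\<in>G. p (y - t *\<^sub>R x)) < e} \<subseteq> U"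
      using openin_seminorm_topology_imp_ball[OF F U] by blast
    have q: "seminorm (\<lambda>x. \<Sum>p\<in>G. p x)"
      using F G(2) by (intro seminorm_sum) blast
    \<comment> \<open>Adding 1 to \<open>\<bar>t\<bar>\<close> in the radius covers
      \<open>t = 0\<close> as well.\<close>
    have "t *\<^sub>R y \<in> U" if "(\<Sum>p\<in>G. p (y - x)) < e / (\<bar>t\<bar> + 1)" for y
    proof -
      have "(\<Sum>p\<in>G. p (t *\<^sub>R y - t *\<^sub>R x)) = \<bar>t\<bar> * (\<Sum>p\<in>G. p (y - x))"
        using seminorm_scaleR[OF q, of t "y - x"] by (simp add: scaleR_diff_right)
      also have "\<dots> \<le> (\<bar>t\<bar> + 1) * (\<Sum>p\<in>G. p (y - x))"
        using seminorm_nonneg[OF q] by (intro mult_right_mono) auto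
      also have "\<dots> < e"
        using that by (simp add: pos_less_divide_eq mult.commute)
      finally show ?thesis
        using G(4) by blast
    qed
    then have "{y. (\<Sum>p\<in>G. p (y - x)) < e / (\<bar>t\<bar> + 1)} \<subseteq> ?V"
      by auto
    then show "\<exists>G e. finite G \<and> G \<subseteq> F \<and> 0 < e \<and> {y. (\<Sum>p\<in>G. p (y - x)) < e} \<subseteq> ?V"
      using G by (intro exI[of _ G] exI[of _ "e / (\<bar>t\<bar> + 1)"]) simp
  qed auto
qed auto

text \<open>Needed to normalise boundary points without leaving the boundary. For closed
  \<open>A\<close> the frontier is \<open>A\<close> minus its interior, and the preimage of an open
  subset of the cone under scaling by \<open>t\<close> is again an open subset of the cone.\<close>

lemma scaleR_in_frontier_of_cone:
  assumes F: "\<And>p. p \<in> F \<Longrightarrow> seminorm p" and A: "closedin (seminorm_topology F) A" "cone A"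
    and a: "a \<in> seminorm_topology F frontier_of A" and "0 < t"
  shows "t *\<^sub>R a \<in> seminorm_topology F frontier_of A"
proof -
  let ?X = "seminorm_topology F"
  have frontier: "?X frontier_of A = A - ?X interior_of A"
    using A(1) by (simp add: frontier_of_def closure_of_closedin)
  have "t *\<^sub>R a \<notin> ?X interior_of A"
  proof
    assume "t *\<^sub>R a \<in> ?X interior_of A"
    then obtain U where U: "openin ?X U" "t *\<^sub>R a \<in> U" "U \<subseteq> A"
      by (auto simp: interior_of_def)
    have "x \<in> A" if "t *\<^sub>R x \<in> A" for x
      using mem_cone[OF A(2) that, of "inverse t"] \<open>0 < t\<close> by simp
    then have "{x. t *\<^sub>R x \<in> U} \<subseteq> A"
      using U(3) by blast
    moreover have "openin ?X {x. t *\<^sub>R x \<in> U}"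
      using openin_continuous_map_preimage[OF continuous_map_scaleR_seminorm_topology[OF F] U(1)]
      by simp
    ultimately have "a \<in> ?X interior_of A"
      using U(2) by (auto simp: interior_of_def)
    then show False
      using a frontier by blast
  qed
  then show ?thesis
    using a frontier mem_cone[OF A(2)] \<open>0 < t\<close> by auto
qed

text \<open>Domination applied to \<open>y - x\<close> and to \<open>x - y\<close> bounds the
  distance between \<open>f y\<close> and \<open>f x\<close> by the sum of seminorms at
  \<open>y - x\<close>.\<close>

lemma continuous_map_linear_dominated:
  assumes F: "\<And>p. p \<in> F \<Longrightarrow> seminorm p" and G: "finite G" "G \<subseteq> F"
    and f: "linear f" "\<And>x. f x \<le> (\<Sum>p\<in>G. p x)"
  shows "continuous_map (seminorm_topology F) euclideanreal f"
  unfolding continuous_map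
proof (intro conjI allI impI)
  fix V :: "real set"
  assume V: "openin euclideanreal V"
  have q: "seminorm (\<lambda>x. \<Sum>p\<in>G. p x)"
    using F G(2) by (intro seminorm_sum) blast
  have dist: "dist (f y) (f x) \<le> (\<Sum>p\<in>G. p (y - x))" for x y
    using f(2)[of "y - x"] f(2)[of "x - y"] seminorm_minus_commute[OF q, of x y]
    by (simp add: dist_real_def linear_diff[OF f(1)] abs_le_iff)
  show "openin (seminorm_topology F) {x \<in> topspace (seminorm_topology F). f x \<in> V}"
  proof (rule openin_seminorm_topologyI[OF F])
    fix x assume "x \<in> {x \<in> topspace (seminorm_topology F). f x \<in> V}"
    then obtain e where e: "0 < e" "\<And>z. dist z (f x) < e \<Longrightarrow> z \<in> V"
      using V by (auto simp: open_dist)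
    have "{y. (\<Sum>p\<in>G. p (y - x)) < e} \<subseteq> {x \<in> topspace (seminorm_topology F). f x \<in> V}"
      using e(2) dist by (auto intro: le_less_trans)
    then show "\<exists>G e. finite G \<and> G \<subseteq> F \<and> 0 < e \<and>
        {y. (\<Sum>p\<in>G. p (y - x)) < e} \<subseteq> {x \<in> topspace (seminorm_topology F). f x \<in> V}"
      using G e(1) by blast
  qed auto
qed auto

text \<open>Around each point of \<open>D\<close> some ball misses \<open>C\<close>. Finitely many
  such balls with halved radius cover \<open>D\<close>, and collecting their seminorms yields one
  sum and one \<open>e\<close> for all pairs; compactness makes the bound uniform.\<close>

lemma seminorm_gap:
  fixes F :: "('a::real_vector \<Rightarrow> real) set"
  assumes F: "\<And>p. p \<in> F \<Longrightarrow> seminorm p"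
    and C: "closedin (seminorm_topology F) C" and D: "compactin (seminorm_topology F) D"
    and disj: "C \<inter> D = {}"
  obtains G e where "finite G" "G \<subseteq> F" "0 < e"
    "\<And>c d. c \<in> C \<Longrightarrow> d \<in> D \<Longrightarrow> e \<le> (\<Sum>p\<in>G. p (c - d))"
proof -
  let ?X = "seminorm_topology F"
  have "\<forall>d\<in>D. \<exists>G e. finite G \<and> G \<subseteq> F \<and> 0 < e \<and> {y. (\<Sum>p\<in>G. p (y - d)) < e} \<subseteq> - C"
  proof
    fix d assume "d \<in> D"
    have "openin ?X (- C)"
      using C by (simp add: closedin_def Compl_eq_Diff_UNIV)
    moreover have "d \<in> - C"
      using disj \<open>d \<in> D\<close> by blast
    ultimately obtain G e where "finite G" "G \<subseteq> F" "0 < e" "{y. (\<Sum>p\<in>G. p (y - d)) < e} \<subseteq> - C"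
      using openin_seminorm_topology_imp_ball[OF F] by metis
    then show "\<exists>G e. finite G \<and> G \<subseteq> F \<and> 0 < e \<and> {y. (\<Sum>p\<in>G. p (y - d)) < e} \<subseteq> - C"
      by blast
  qed
  then obtain G r where G: "\<And>d. d \<in> D \<Longrightarrow> finite (G d)" "\<And>d. d \<in> D \<Longrightarrow> G d \<subseteq> F"
    and r: "\<And>d. d \<in> D \<Longrightarrow> 0 < r d"
    and avoid: "\<And>d. d \<in> D \<Longrightarrow> {y. (\<Sum>p\<in>G d. p (y - d)) < r d} \<subseteq> - C"
    by metis
  define B where "B = (\<lambda>d. {y. (\<Sum>p\<in>G d. p (y - d)) < r d / 2})"
  have "openin ?X (B d)" if "d \<in> D" for d
    unfolding B_def using openin_seminorm_ball[OF F G(1,2)[OF that]] .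
  moreover have "D \<subseteq> \<Union> (B ` D)"
  proof
    fix d assume "d \<in> D"
    then have "(\<Sum>p\<in>G d. p 0) = 0"
      using G(2) F seminorm_zero by (intro sum.neutral) blast
    then show "d \<in> \<Union> (B ` D)"
      using \<open>d \<in> D\<close> r by (auto simp: B_def intro!: bexI[of _ d])
  qed
  ultimately obtain \<B> where "finite \<B>" "\<B> \<subseteq> B ` D" "D \<subseteq> \<Union>\<B>"
    using D unfolding compactin_def by (metis (no_types, lifting) imageE)
  then obtain D0 where D0: "finite D0" "D0 \<subseteq> D" "D \<subseteq> \<Union> (B ` D0)"
    by (metis finite_subset_image)
  define H where "H = \<Union> (G ` D0)"
  \<comment> \<open>Half of the smallest radius remains after the triangle inequality. Inserting 1
    keeps \<open>Min\<close> meaningful when \<open>D0\<close> is empty.\<close>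
  define e where "e = Min (insert 1 (r ` D0)) / 2"
  have H: "finite H" "H \<subseteq> F"
    using D0(1,2) G by (auto simp: H_def)
  have "0 < e"
    using D0(1,2) r by (auto simp: e_def)
  moreover have "e \<le> (\<Sum>p\<in>H. p (c - d))" if "c \<in> C" "d \<in> D" for c d
  proof -
    obtain d0 where d0: "d0 \<in> D0" "d \<in> B d0"
      using D0(3) \<open>d \<in> D\<close> by blast
    then have "d0 \<in> D"
      using D0(2) by blast
    have q: "seminorm (\<lambda>x. \<Sum>p\<in>G d0. p x)"
      using F G(2)[OF \<open>d0 \<in> D\<close>] by (intro seminorm_sum) blast
    have far: "r d0 \<le> (\<Sum>p\<in>G d0. p (c - d0))"
      using avoid[OF \<open>d0 \<in> D\<close>] \<open>c \<in> C\<close> by force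
    have "e \<le> r d0 / 2"
      using D0(1) d0(1) by (auto simp: e_def)
    also have "\<dots> \<le> (\<Sum>p\<in>G d0. p (c - d))"
      using far seminorm_triangle[OF q, of c d0 d] d0(2) by (simp add: B_def)
    also have "\<dots> \<le> (\<Sum>p\<in>H. p (c - d))"
      using H d0(1) F by (intro sum_mono2) (auto simp: H_def intro: seminorm_nonneg)
    finally show ?thesis .
  qed
  ultimately show ?thesis
    using that H by blast
qed

text \<open>The gap is measured between the closed sets \<open>C\<close> and \<open>D\<close>, while
  Mazur--Orlicz is applied to differences of the convex subsets \<open>S\<close> and
  \<open>T\<close>. In the application these are convex hulls, and \<open>C\<close> and
  \<open>D\<close> are their closures.\<close>

theorem strict_separation:
  fixes F :: "('a::real_vector \<Rightarrow> real) set"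
  assumes F: "\<And>p. p \<in> F \<Longrightarrow> seminorm p"
    and C: "closedin (seminorm_topology F) C" and D: "closedin (seminorm_topology F) D"
    and compact: "compactin (seminorm_topology F) C \<or> compactin (seminorm_topology F) D"
    and disj: "C \<inter> D = {}" and sub: "S \<subseteq> C" "T \<subseteq> D"
    and "convex S" "convex T" "S \<noteq> {}" "T \<noteq> {}"
  obtains f e where "f \<in> topological_dual (seminorm_topology F)" "0 < e"
    "\<And>x y. x \<in> S \<Longrightarrow> y \<in> T \<Longrightarrow> f y + e \<le> f x"
proof -
  have "\<exists>G e. finite G \<and> G \<subseteq> F \<and> 0 < e \<and> (\<forall>x\<in>C. \<forall>y\<in>D. e \<le> (\<Sum>p\<in>G. p (x - y)))"
    using compact
  proof
    assume "compactin (seminorm_topology F) D"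
    then show ?thesis
      using seminorm_gap[OF F C _ disj] by metis
  next
    \<comment> \<open>The same gap lemma with the roles exchanged; symmetry of seminorms restores
      the order of the difference.\<close>
    assume "compactin (seminorm_topology F) C"
    moreover have "D \<inter> C = {}"
      using disj by blast
    ultimately obtain G e where G: "finite G" "G \<subseteq> F" "0 < e"
      and e: "\<And>y x. y \<in> D \<Longrightarrow> x \<in> C \<Longrightarrow> e \<le> (\<Sum>p\<in>G. p (y - x))"
      using seminorm_gap[OF F D] by metis
    have "seminorm (\<lambda>x. \<Sum>p\<in>G. p x)"
      using F G(2) by (intro seminorm_sum) blast
    then have "e \<le> (\<Sum>p\<in>G. p (x - y))" if "x \<in> C" "y \<in> D" for x y
      using e[OF that(2,1)] seminorm_minus_commute by fastforce
    then show ?thesis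
      using G by blast
  qed
  then obtain G e where G: "finite G" "G \<subseteq> F" "0 < e"
    and e: "\<And>x y. x \<in> C \<Longrightarrow> y \<in> D \<Longrightarrow> e \<le> (\<Sum>p\<in>G. p (x - y))"
    by blast
  define M where "M = (\<Union>x\<in>S. \<Union>y\<in>T. {x - y})"
  have "sublinear (\<lambda>x. \<Sum>p\<in>G. p x)"
    using F G(2) seminorm_sum[of G] by (auto simp: seminorm_def)
  moreover have "convex M"
    unfolding M_def using \<open>convex S\<close> \<open>convex T\<close> by (rule convex_differences)
  moreover have "M \<noteq> {}"
    using \<open>S \<noteq> {}\<close> \<open>T \<noteq> {}\<close> by (auto simp: M_def)
  moreover have "e \<le> (\<Sum>p\<in>G. p m)" if "m \<in> M" for m
    using that e sub by (auto simp: M_def)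
  ultimately obtain f where f: "linear f" "\<And>x. f x \<le> (\<Sum>p\<in>G. p x)" "\<And>m. m \<in> M \<Longrightarrow> e \<le> f m"
    using Mazur_Orlicz by (smt (verit, best))
  have "f y + e \<le> f x" if "x \<in> S" "y \<in> T" for x y
    using f(3)[of "x - y"] that by (force simp: M_def linear_diff[OF f(1)])
  moreover have "f \<in> topological_dual (seminorm_topology F)"
    using continuous_map_linear_dominated[OF F G(1,2) f(1,2)] f(1)
    by (simp add: topological_dual_def algebraic_dual_def)
  ultimately show ?thesis
    using that G(3) by blast
qed

section \<open>Separation of cones\<close>

lemma normalize_in_normlike_base:
  assumes "seminorm \<psi>" and "cone K" and "has_normlike_base \<psi> K" and "x \<in> K" and "x \<noteq> 0"
  shows "0 < \<psi> x" and "inverse (\<psi> x) *\<^sub>R x \<in> normlike_base \<psi> K"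
proof -
  show pos: "0 < \<psi> x"
    using assms(3-5) by (simp add: has_normlike_base_def)
  then show "inverse (\<psi> x) *\<^sub>R x \<in> normlike_base \<psi> K"
    using mem_cone[OF assms(2,4)] seminorm_scaleR[OF assms(1)] by (simp add: normlike_base_def)
qed

text \<open>The preimage of a closed interval under \<open>f\<close> is convex by linearity and
  closed by continuity, so it absorbs both the hull and the closure.\<close>

lemma closure_of_convex_hull_subset_halfspace:
  assumes f: "f \<in> topological_dual \<tau>"
  shows "S \<subseteq> {x. f x \<le> c} \<Longrightarrow> \<tau> closure_of (convex hull S) \<subseteq> {x. f x \<le> c}"
    and "S \<subseteq> {x. c \<le> f x} \<Longrightarrow> \<tau> closure_of (convex hull S) \<subseteq> {x. c \<le> f x}"
proof -
  have lin: "linear f" and cont: "continuous_map \<tau> euclideanreal f"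
    using f by (auto simp: topological_dual_def algebraic_dual_def)
  have halfspace: "\<tau> closure_of (convex hull S) \<subseteq> {x. f x \<in> I}"
    if "S \<subseteq> {x. f x \<in> I}" "closed I" "convex I" for I
  proof -
    have "convex hull S \<subseteq> f -` I"
      using that lin by (intro hull_minimal convex_linear_vimage) auto
    then have "\<tau> closure_of (convex hull S) \<subseteq> \<tau> closure_of (f -` I)"
      by (rule closure_of_mono)
    also have "\<dots> = \<tau> closure_of (topspace \<tau> \<inter> f -` I)"
      by (metis closure_of_restrict)
    also have "\<dots> \<subseteq> topspace \<tau> \<inter> f -` I"
      using closedin_continuous_map_preimage[OF cont, of I] that(2)
      by (intro closure_of_minimal) (auto simp: vimage_def Int_def)
    finally show ?thesis
      by auto
  qed
  show "S \<subseteq> {x. f x \<le> c} \<Longrightarrow> \<tau> closure_of (convex hull S) \<subseteq> {x. f x \<le> c}"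
    using halfspace[of "{..c}"] by simp
  show "S \<subseteq> {x. c \<le> f x} \<Longrightarrow> \<tau> closure_of (convex hull S) \<subseteq> {x. c \<le> f x}"
    using halfspace[of "{c..}"] by simp
qed

text \<open>Strict form of the first implication. The zero vector, where both sides become
  equalities, is excluded here and treated separately.\<close>

lemma separation_by_aug_dual:
  fixes F :: "('a::real_vector \<Rightarrow> real) set"
  assumes F: "\<And>p. p \<in> F \<Longrightarrow> seminorm p" and \<tau>: "\<tau> = seminorm_topology F"
    and \<psi>: "seminorm \<psi>"
    and K: "cone K" "0 \<in> K" "K \<noteq> {0}" "has_normlike_base \<psi> K"
    and A: "closedin \<tau> A" "cone A" "has_normlike_base \<psi> A"
    and S: "S = convex hull (uminus ` normlike_base \<psi> K)"
    and S0: "S0 = convex hull ((normlike_base \<psi> A \<inter> \<tau> frontier_of A) \<union> {0})"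
    and compact: "compactin \<tau> (\<tau> closure_of S) \<or> compactin \<tau> (\<tau> closure_of S0)"
    and disj: "\<tau> closure_of S0 \<inter> \<tau> closure_of S = {}"
  obtains f \<alpha> where "(f, \<alpha>) \<in> top_aug_dual_sharp \<tau> \<psi> K" and "0 < \<alpha>"
    and "\<And>a. a \<in> \<tau> frontier_of A - {0} \<Longrightarrow> 0 < f a + \<alpha> * \<psi> a"
    and "\<And>k. k \<in> K - {0} \<Longrightarrow> f (- k) + \<alpha> * \<psi> (- k) < 0"
proof -
  obtain k0 where "k0 \<in> K" "k0 \<noteq> 0"
    using K(2,3) by blast
  then have S_ne: "S \<noteq> {}"
    using normalize_in_normlike_base(2)[OF \<psi> K(1,4)] S by auto
  have base: "uminus ` normlike_base \<psi> K \<subseteq> S"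
    and "normlike_base \<psi> A \<inter> \<tau> frontier_of A \<union> {0} \<subseteq> S0"
    unfolding S S0 by (rule hull_subset)+
  then have base0: "normlike_base \<psi> A \<inter> \<tau> frontier_of A \<subseteq> S0" and "0 \<in> S0"
    by auto
  obtain f e where f: "f \<in> topological_dual \<tau>" and "0 < e"
    and sep: "\<And>x y. x \<in> S0 \<Longrightarrow> y \<in> S \<Longrightarrow> f y + e \<le> f x"
  proof (rule strict_separation[OF F])
    show "closedin (seminorm_topology F) (\<tau> closure_of S0)"
      "closedin (seminorm_topology F) (\<tau> closure_of S)"
      by (simp_all add: \<tau>)
    show "compactin (seminorm_topology F) (\<tau> closure_of S0) \<or>
        compactin (seminorm_topology F) (\<tau> closure_of S)"
      using compact \<tau> by blast
    show "\<tau> closure_of S0 \<inter> \<tau> closure_of S = {}"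
      by (fact disj)
    show "S0 \<subseteq> \<tau> closure_of S0" "S \<subseteq> \<tau> closure_of S"
      by (simp_all add: \<tau> closure_of_subset)
    show "convex S0" "convex S"
      by (simp_all add: S S0)
    show "S0 \<noteq> {}" "S \<noteq> {}"
      using \<open>0 \<in> S0\<close> S_ne by auto
  qed (use that \<tau> in auto)
  have lin: "linear f"
    using f by (simp add: topological_dual_def algebraic_dual_def)
  have bdd: "bdd_above (f ` S)"
    using sep[OF \<open>0 \<in> S0\<close>] by (intro bdd_aboveI2[of _ _ "f 0 - e"]) (simp add: le_diff_eq)
  \<comment> \<open>The level \<open>- \<alpha>\<close> lies \<open>e / 2\<close> above the supremum
    over \<open>S\<close>, inside the gap of width at least \<open>e\<close>, so both resulting
    inequalities are strict.\<close>
  define \<alpha> where "\<alpha> = - (SUP y\<in>S. f y) - e / 2"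
  have upper: "f y < - \<alpha>" if "y \<in> S" for y
    using cSUP_upper[OF that bdd] \<open>0 < e\<close> by (simp add: \<alpha>_def)
  have lower: "- \<alpha> < f x" if "x \<in> S0" for x
  proof -
    have "(SUP y\<in>S. f y) \<le> f x - e"
      using sep[OF that] by (intro cSUP_least[OF S_ne]) (simp add: le_diff_eq)
    then show ?thesis
      using \<open>0 < e\<close> by (simp add: \<alpha>_def)
  qed
  have "0 < \<alpha>"
    using lower[OF \<open>0 \<in> S0\<close>] linear_0[OF lin] by simp
  have K_sep: "0 < f k - \<alpha> * \<psi> k" if "k \<in> K - {0}" for k
  proof -
    have k: "0 < \<psi> k" "inverse (\<psi> k) *\<^sub>R k \<in> normlike_base \<psi> K"
      using normalize_in_normlike_base[OF \<psi> K(1,4)] that by auto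
    have "f (- (inverse (\<psi> k) *\<^sub>R k)) < - \<alpha>"
      using k(2) base by (intro upper) blast
    then have "\<alpha> < f k / \<psi> k"
      by (simp add: linear_neg[OF lin] linear_scale[OF lin] field_simps)
    then show ?thesis
      using k(1) by (simp add: pos_less_divide_eq)
  qed
  have A_sep: "0 < f a + \<alpha> * \<psi> a" if "a \<in> \<tau> frontier_of A - {0}" for a
  proof -
    have "a \<in> A"
      using that frontier_of_subset_closedin[OF A(1)] by blast
    then have a: "0 < \<psi> a" "inverse (\<psi> a) *\<^sub>R a \<in> normlike_base \<psi> A"
      using normalize_in_normlike_base[OF \<psi> A(2,3)] that by auto
    have "inverse (\<psi> a) *\<^sub>R a \<in> \<tau> frontier_of A"
      using that a(1) A(1,2) unfolding \<tau> by (intro scaleR_in_frontier_of_cone[OF F]) auto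
    then have "- \<alpha> < f (inverse (\<psi> a) *\<^sub>R a)"
      using a(2) base0 by (intro lower) blast
    then have "- \<alpha> < f a / \<psi> a"
      by (simp add: linear_scale[OF lin] field_simps)
    then show ?thesis
      using a(1) by (simp add: pos_less_divide_eq)
  qed
  \<comment> \<open>Membership in \<open>dual_sharp\<close>: \<open>f k\<close> exceeds
    \<open>\<alpha> * \<psi> k\<close>, which is nonnegative.\<close>
  have "0 < f k" if "k \<in> K - {0}" for k
    using K_sep[OF that] \<open>0 < \<alpha>\<close> seminorm_nonneg[OF \<psi>, of k]
    by (smt (verit) mult_nonneg_nonneg)
  then have "(f, \<alpha>) \<in> top_aug_dual_sharp \<tau> \<psi> K"
    using K_sep f lin \<open>0 < \<alpha>\<close>
    by (auto simp: top_aug_dual_sharp_def aug_dual_sharp_def dual_sharp_def algebraic_dual_def)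
  moreover have "f (- k) + \<alpha> * \<psi> (- k) < 0" if "k \<in> K - {0}" for k
    using K_sep[OF that] by (simp add: linear_neg[OF lin] seminorm_minus[OF \<psi>])
  ultimately show ?thesis
    using that \<open>0 < \<alpha>\<close> A_sep by blast
qed

text \<open>On the compact base \<open>f\<close> attains its minimum at some \<open>b\<close>, and
  \<open>f b > \<alpha>\<close> because \<open>\<psi> b = 1\<close>. The two closures then lie in
  the disjoint half-spaces \<open>f \<ge> - \<alpha>\<close> and
  \<open>f \<le> - f b\<close>.\<close>

lemma closures_disjoint_of_aug_dual:
  assumes \<psi>: "seminorm \<psi>"
    and f: "(f, \<alpha>) \<in> top_aug_dual_sharp \<tau> \<psi> K" and "0 < \<alpha>"
    and A: "\<And>a. a \<in> B \<Longrightarrow> - \<alpha> \<le> f a"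
    and compact: "compactin \<tau> (normlike_base \<psi> K)"
  shows "\<tau> closure_of (convex hull (B \<union> {0})) \<inter>
    \<tau> closure_of (convex hull (uminus ` normlike_base \<psi> K)) = {}"
proof -
  let ?B = "normlike_base \<psi> K"
  have dual: "f \<in> topological_dual \<tau>" and K_sep: "\<And>k. k \<in> K - {0} \<Longrightarrow> 0 < f k - \<alpha> * \<psi> k"
    using f by (auto simp: top_aug_dual_sharp_def aug_dual_sharp_def)
  have lin: "linear f" and cont: "continuous_map \<tau> euclideanreal f"
    using dual by (auto simp: topological_dual_def algebraic_dual_def)
  show ?thesis
  proof (cases "?B = {}")
    case True
    then show ?thesis
      by simp
  next
    case False
    have "compact (f ` ?B)"
      using image_compactin[OF compact cont] by simp
    then obtain b where b: "b \<in> ?B" "\<And>k. k \<in> ?B \<Longrightarrow> f b \<le> f k"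
      using compact_attains_inf[of "f ` ?B"] False by auto
    have "b \<in> K - {0}" and "\<psi> b = 1"
      using b(1) seminorm_zero[OF \<psi>] by (auto simp: normlike_base_def)
    then have "\<alpha> < f b"
      using K_sep by fastforce
    have "uminus ` ?B \<subseteq> {x. f x \<le> - f b}"
      using b(2) by (auto simp: linear_neg[OF lin])
    then have "\<tau> closure_of (convex hull (uminus ` ?B)) \<subseteq> {x. f x \<le> - f b}"
      by (rule closure_of_convex_hull_subset_halfspace(1)[OF dual])
    \<comment> \<open>The added point 0 satisfies the bound because \<open>\<alpha>\<close> is
      positive.\<close>
    moreover have "B \<union> {0} \<subseteq> {x. - \<alpha> \<le> f x}"
      using A \<open>0 < \<alpha>\<close> by (auto simp: linear_0[OF lin])
    then have "\<tau> closure_of (convex hull (B \<union> {0})) \<subseteq> {x. - \<alpha> \<le> f x}"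
      by (rule closure_of_convex_hull_subset_halfspace(2)[OF dual])
    ultimately show ?thesis
      using \<open>\<alpha> < f b\<close> by fastforce
  qed
qed

section \<open>Assembly of the two implications\<close>

theorem corollary5p15:
  fixes F :: "('a::real_vector \<Rightarrow> real) set" and \<tau> :: "'a topology"
    and \<psi> :: "'a \<Rightarrow> real" and K A :: "'a set"
  assumes "locally_convex_space F \<tau>"
    and "seminorm \<psi>"
    and "nontrivial_cone K" and "pointed K" and "has_normlike_base \<psi> K"
    and "closedin \<tau> A" and "nontrivial_cone A" and "has_normlike_base \<psi> A"
  shows
    "let B_K = normlike_base \<psi> K;
         B_A = normlike_base \<psi> A;
         bdA = \<tau> frontier_of A;
         S_negK = convex hull (uminus ` B_K);
         S0_bdA = convex hull ((B_A \<inter> bdA) \<union> {0});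
         assertion1 = ((\<tau> closure_of S0_bdA) \<inter> (\<tau> closure_of S_negK) = {});
         assertion2 = (\<exists>(x', \<alpha>) \<in> top_aug_dual_sharp \<tau> \<psi> K \<inter> (topological_dual \<tau> \<times> {0<..}).
            (\<forall>a \<in> bdA. \<forall>k \<in> uminus ` K.
               x' a + \<alpha> * \<psi> a \<ge> 0 \<and> 0 \<ge> x' k + \<alpha> * \<psi> k) \<and>
            (\<forall>a \<in> bdA - {0}. \<forall>k \<in> (uminus ` K) - {0}.
               x' a + \<alpha> * \<psi> a > 0 \<and> 0 > x' k + \<alpha> * \<psi> k))
     in (compactin \<tau> (\<tau> closure_of S_negK) \<or> compactin \<tau> (\<tau> closure_of S0_bdA)
           \<longrightarrow> assertion1 \<longrightarrow> assertion2) \<and>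
        (compactin \<tau> B_K \<or>
         compactin \<tau> (\<tau> closure_of S_negK) \<and> continuous_map \<tau> euclideanreal \<psi> \<and>
           closedin \<tau> K \<and> convex K
           \<longrightarrow> assertion2 \<longrightarrow> assertion1)"
proof -
  define B_K where "B_K = normlike_base \<psi> K"
  define B_A where "B_A = normlike_base \<psi> A"
  define bdA where "bdA = \<tau> frontier_of A"
  define S where "S = convex hull (uminus ` B_K)"
  define S0 where "S0 = convex hull ((B_A \<inter> bdA) \<union> {0})"
  define separated where "separated = (\<exists>(x', \<alpha>) \<in> top_aug_dual_sharp \<tau> \<psi> K \<inter> (topological_dual \<tau> \<times> {0<..}).
    (\<forall>a \<in> bdA. \<forall>k \<in> uminus ` K.
       x' a + \<alpha> * \<psi> a \<ge> 0 \<and> 0 \<ge> x' k + \<alpha> * \<psi> k) \<and>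
    (\<forall>a \<in> bdA - {0}. \<forall>k \<in> (uminus ` K) - {0}.
       x' a + \<alpha> * \<psi> a > 0 \<and> 0 > x' k + \<alpha> * \<psi> k))"
  have F: "\<And>p. p \<in> F \<Longrightarrow> seminorm p" and \<tau>: "\<tau> = seminorm_topology F"
    using assms(1) by (auto simp: locally_convex_space_def)
  have K: "cone K" "0 \<in> K" "K \<noteq> {0}" and A: "cone A"
    using assms(3,7) by (auto simp: nontrivial_cone_def is_cone_iff_cone)
  have first: separated
    if compact: "compactin \<tau> (\<tau> closure_of S) \<or> compactin \<tau> (\<tau> closure_of S0)"
      and disj: "\<tau> closure_of S0 \<inter> \<tau> closure_of S = {}"
  proof -
    obtain f \<alpha> where f: "(f, \<alpha>) \<in> top_aug_dual_sharp \<tau> \<psi> K" and "0 < \<alpha>"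
      and bd: "\<And>a. a \<in> bdA - {0} \<Longrightarrow> 0 < f a + \<alpha> * \<psi> a"
      and neg: "\<And>k. k \<in> K - {0} \<Longrightarrow> f (- k) + \<alpha> * \<psi> (- k) < 0"
      using separation_by_aug_dual[OF F \<tau> assms(2) K assms(5,6) A assms(8)
          S_def[unfolded B_K_def] S0_def[unfolded B_A_def bdA_def] compact disj]
      unfolding bdA_def by blast
    have dual: "f \<in> topological_dual \<tau>"
      using f by (simp add: top_aug_dual_sharp_def)
    \<comment> \<open>Equality at 0 extends the strict inequalities to the weak ones on all of
      \<open>bdA\<close> and of \<open>- K\<close>.\<close>
    have zero: "f 0 + \<alpha> * \<psi> 0 = 0"
      using dual linear_0[of f] seminorm_zero[OF assms(2)]
      by (simp add: topological_dual_def algebraic_dual_def)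
    have "0 \<le> f a + \<alpha> * \<psi> a" if "a \<in> bdA" for a
      using bd[of a] zero that by (cases "a = 0") auto
    moreover have "f k + \<alpha> * \<psi> k < 0" if "k \<in> uminus ` K - {0}" for k
      using neg that by auto
    moreover from this have "f k + \<alpha> * \<psi> k \<le> 0" if "k \<in> uminus ` K" for k
      using zero that by (cases "k = 0") (auto intro: less_imp_le)
    ultimately show ?thesis
      unfolding separated_def using f dual \<open>0 < \<alpha>\<close> bd by (intro bexI[of _ "(f, \<alpha>)"]) auto
  qed
  have compact_case: "\<tau> closure_of S0 \<inter> \<tau> closure_of S = {}" if "compactin \<tau> B_K" and separated
  proof -
    obtain f \<alpha> where f: "(f, \<alpha>) \<in> top_aug_dual_sharp \<tau> \<psi> K" "0 < \<alpha>"
      and bd: "\<And>a k. a \<in> bdA \<Longrightarrow> k \<in> uminus ` K \<Longrightarrow> 0 \<le> f a + \<alpha> * \<psi> a"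
      using \<open>separated\<close> unfolding separated_def by auto
    have "- \<alpha> \<le> f a" if "a \<in> B_A \<inter> bdA" for a
      \<comment> \<open>The inequalities are quantified over pairs, so a point of \<open>- K\<close>
        must be supplied; 0 will do.\<close>
      using bd[of a 0] that K(2) by (force simp: B_A_def normlike_base_def)
    then show ?thesis
      using closures_disjoint_of_aug_dual[OF assms(2) f] that(1)
      unfolding S_def S0_def B_K_def by blast
  qed
  \<comment> \<open>Reduction of (b) to (a): \<open>- B_K\<close> is closed and contained in the
    compact closure of \<open>S\<close>, hence compact, and negating once more gives
    \<open>B_K\<close>. Negation is written as scaling by \<open>- 1\<close> to reuse the continuity
    of scaling.\<close>
  have "compactin \<tau> B_K"
    if S: "compactin \<tau> (\<tau> closure_of S)" and \<psi>: "continuous_map \<tau> euclideanreal \<psi>" and "closedin \<tau> K"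
  proof -
    have neg: "continuous_map \<tau> \<tau> (\<lambda>x. (- 1) *\<^sub>R x)"
      unfolding \<tau> by (rule continuous_map_scaleR_seminorm_topology[OF F])
    have "closedin \<tau> {x \<in> topspace \<tau>. \<psi> x \<in> {1}}"
      by (rule closedin_continuous_map_preimage[OF \<psi>]) simp
    then have "closedin \<tau> (K \<inter> {x \<in> topspace \<tau>. \<psi> x \<in> {1}})"
      using \<open>closedin \<tau> K\<close> by (rule closedin_Int[rotated])
    then have "closedin \<tau> B_K"
      by (simp add: B_K_def normlike_base_def \<tau> Int_def)
    from closedin_continuous_map_preimage[OF neg this]
    have "closedin \<tau> {x. - x \<in> B_K}"
      by (simp add: \<tau>)
    also have "{x. - x \<in> B_K} = uminus ` B_K"
      by force
    finally have "closedin \<tau> (uminus ` B_K)" .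
    moreover have "uminus ` B_K \<subseteq> \<tau> closure_of S"
      using hull_subset[of "uminus ` B_K" convex] closure_of_subset[of S \<tau>]
      by (auto simp: S_def \<tau>)
    ultimately have "compactin \<tau> (uminus ` B_K)"
      using closed_compactin[OF S] by blast
    from image_compactin[OF this neg] show ?thesis
      by (simp add: image_image)
  qed
  then show ?thesis
    using first compact_case
    unfolding Let_def B_K_def B_A_def bdA_def S_def S0_def separated_def by blast
qed

end
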